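(* Every stationary random countable set over the Wiener noise admits a version that is perfectly stationary, countable with certainty (i.e. its value at every $\omega\in\Omega_0$ is a countable set) and that belongs to $\mathcal{B}_{\Omega_0}\otimes\mathcal{B}_{\mathbb{R}}$.
   Context: $\Omega_0:=\{\omega:\mathbb{R}\to\mathbb{R}\text{ continuous},\ \omega(0)=0\}$ with the locally uniform topology and Borel $\sigma$-field $\mathcal{B}_{\Omega_0}$, canonical process $B=(B_t)_{t\in\mathbb{R}}$. $\mathsf{W}$ is the completed two-sided Wiener measure: $(B_t)_{t\ge0}$ and $(B_{-t})_{t\ge 0}$ are independent standard Brownian motions under $\mathsf{W}$; its domain $\mathcal{G}$ is the $\mathsf{W}$-completion of $\mathcal{B}_{\Omega_0}$. For $u\in\mathbb{R}$ the Lévy shift $\Delta_u:\Omega_0\to\Omega_0$ is $\Delta_u(\omega)(t):=\omega(u+t)-\omega(u)$. $\dagger\notin\mathbb{R}$ is a coffin state; $\mathbb{R}^\dagger:=\mathbb{R}\cup\{\dagger\}$ with the $\sigma$-field generated by the Borel sets of $\mathbb{R}$ and $\{\dagger\}$. For a sequence $s=(s_i)_{i\in\mathbb{N}}$ in $\mathbb{R}^\dagger$, $[s]:=\{s_i:i\in\mathbb{N}\}\setminus\{\dagger\}$. A random set is a map $M:\Omega_0\to 2^{\mathbb{R}}$; it is identified with the subset $\{(\omega,t):t\in M(\omega)\}$ of $\Omega_0\times\mathbb{R}$. $M$ is a random countable set if there is a sequence $S=(S_i)_{i\in\mathbb{N}}$ of $\mathcal{G}$-measurable $\mathbb{R}^\dagger$-valued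 random variables with $M=[S]$ $\mathsf{W}$-a.s. A random countable set $M$ is stationary if for every $u\in\mathbb{R}$, $M=u+M(\Delta_u)$ $\mathsf{W}$-a.s.; perfectly stationary if for every $u\in\mathbb{R}$ this equality holds at every $\omega\in\Omega_0$. $M'$ is a version of $M$ if $\{M=M'\}\in\mathcal{G}$ and $\mathsf{W}(M=M')=1$. *)

theory Defs
  imports "HOL-Probability.Probability"
begin

definition Omega0 :: "(real \<Rightarrow> real) set" where
  "Omega0 = {\<omega>. continuous_on UNIV \<omega> \<and> \<omega> 0 = 0}"

text \<open>Neighbourhoods of \<open>\<omega>\<close> in the locally uniform topology are given by closeness, up to
  some \<open>\<epsilon> > 0\<close>, uniformly on some compact set.\<close>

definition loc_unif_open :: "(real \<Rightarrow> real) set \<Rightarrow> bool" where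
  "loc_unif_open U \<longleftrightarrow> U \<subseteq> Omega0 \<and>
     (\<forall>\<omega>\<in>U. \<exists>K \<epsilon>. compact K \<and> \<epsilon> > 0 \<and> {\<eta>\<in>Omega0. \<forall>t\<in>K. dist (\<eta> t) (\<omega> t) < \<epsilon>} \<subseteq> U)"

definition loc_unif_topology :: "(real \<Rightarrow> real) topology" where
  "loc_unif_topology = topology loc_unif_open"

lemma istopology_loc_unif_open: "istopology loc_unif_open"
  unfolding istopology_def
proof (intro conjI allI impI)
  fix S T assume S: "loc_unif_open S" and T: "loc_unif_open T"
  show "loc_unif_open (S \<inter> T)"
    unfolding loc_unif_open_def
  proof (intro conjI ballI)
    show "S \<inter> T \<subseteq> Omega0"
      using S by (auto simp: loc_unif_open_def)
    fix \<omega> assume \<omega>: "\<omega> \<in> S \<inter> T"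
    obtain K e where K: "compact K" "e > 0" "{\<eta>\<in>Omega0. \<forall>t\<in>K. dist (\<eta> t) (\<omega> t) < e} \<subseteq> S"
      using S \<omega> unfolding loc_unif_open_def by blast
    obtain L d where L: "compact L" "d > 0" "{\<eta>\<in>Omega0. \<forall>t\<in>L. dist (\<eta> t) (\<omega> t) < d} \<subseteq> T"
      using T \<omega> unfolding loc_unif_open_def by blast
    have "{\<eta>\<in>Omega0. \<forall>t\<in>K \<union> L. dist (\<eta> t) (\<omega> t) < min e d} \<subseteq> S \<inter> T"
      using K(3) L(3) by auto
    then show "\<exists>K \<epsilon>. compact K \<and> \<epsilon> > 0 \<and> {\<eta>\<in>Omega0. \<forall>t\<in>K. dist (\<eta> t) (\<omega> t) < \<epsilon>} \<subseteq> S \<inter> T"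
      using compact_Un[OF K(1) L(1)] K(2) L(2)
      by (intro exI[of _ "K \<union> L"] exI[of _ "min e d"] conjI) simp_all
  qed
next
  fix \<K> assume \<K>: "\<forall>S\<in>\<K>. loc_unif_open S"
  show "loc_unif_open (\<Union>\<K>)"
    unfolding loc_unif_open_def
  proof (intro conjI ballI)
    show "\<Union>\<K> \<subseteq> Omega0"
      using \<K> by (auto simp: loc_unif_open_def)
    fix \<omega> assume "\<omega> \<in> \<Union>\<K>"
    then obtain S where S: "S \<in> \<K>" "\<omega> \<in> S" by blast
    then have "loc_unif_open S"
      using \<K> by blast
    with S(2) obtain K e where K: "compact K" "e > 0"
        "{\<eta>\<in>Omega0. \<forall>t\<in>K. dist (\<eta> t) (\<omega> t) < e} \<subseteq> S"
      unfolding loc_unif_open_def by blast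
    from K(3) S(1) have "{\<eta>\<in>Omega0. \<forall>t\<in>K. dist (\<eta> t) (\<omega> t) < e} \<subseteq> \<Union>\<K>"
      by blast
    with K(1,2) show "\<exists>K \<epsilon>. compact K \<and> \<epsilon> > 0 \<and> {\<eta>\<in>Omega0. \<forall>t\<in>K. dist (\<eta> t) (\<omega> t) < \<epsilon>} \<subseteq> \<Union>\<K>"
      by blast
  qed
qed

lemma openin_loc_unif_topology: "openin loc_unif_topology U \<longleftrightarrow> loc_unif_open U"
  unfolding loc_unif_topology_def using istopology_loc_unif_open
  by (simp add: topology_inverse')

lemma topspace_loc_unif_topology: "topspace loc_unif_topology = Omega0"
proof -
  have "loc_unif_open Omega0"
    unfolding loc_unif_open_def
    by (intro conjI ballI subset_refl exI[of _ "{}"] exI[of _ "1::real"]) auto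
  then show ?thesis
    unfolding topspace_def openin_loc_unif_topology by (auto simp: loc_unif_open_def)
qed

definition borel_Omega0 :: "(real \<Rightarrow> real) measure" where
  "borel_Omega0 = sigma Omega0 {U. openin loc_unif_topology U}"

lemma space_borel_Omega0: "space borel_Omega0 = Omega0"
  unfolding borel_Omega0_def
  by (rule space_measure_of) (auto simp: openin_loc_unif_topology loc_unif_open_def)

text \<open>Only the values \<open>X t\<close> for \<open>t \<ge> 0\<close> matter. The second argument of
  \<^const>\<open>normal_density\<close> is the standard deviation.\<close>

definition standard_brownian_motion :: "'a measure \<Rightarrow> (real \<Rightarrow> 'a \<Rightarrow> real) \<Rightarrow> bool" where
  "standard_brownian_motion P X \<longleftrightarrow>
     prob_space P \<and>
     (\<forall>t\<ge>0. X t \<in> borel_measurable P) \<and>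
     (AE \<omega> in P. X 0 \<omega> = 0) \<and>
     (AE \<omega> in P. continuous_on {0..} (\<lambda>t. X t \<omega>)) \<and>
     (\<forall>s t. 0 \<le> s \<and> s < t \<longrightarrow>
        distributed P lborel (\<lambda>\<omega>. X t \<omega> - X s \<omega>) (normal_density 0 (sqrt (t - s)))) \<and>
     (\<forall>(n::nat) \<tau>. (\<forall>i\<le>n. 0 \<le> \<tau> i) \<and> (\<forall>i<n. \<tau> i < \<tau> (Suc i)) \<longrightarrow>
        prob_space.indep_vars P (\<lambda>_. borel) (\<lambda>i \<omega>. X (\<tau> (Suc i)) \<omega> - X (\<tau> i) \<omega>) {..<n})"

text \<open>Independence of the two halves is independence of the processes as random elements of
  the space of all functions on \<^term>\<open>{0::real..}\<close> with the product \<open>\<sigma>\<close>-field.\<close>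

definition two_sided_wiener_measure :: "(real \<Rightarrow> real) measure \<Rightarrow> bool" where
  "two_sided_wiener_measure P \<longleftrightarrow>
     sets P = sets borel_Omega0 \<and>
     prob_space P \<and>
     standard_brownian_motion P (\<lambda>t \<omega>. \<omega> t) \<and>
     standard_brownian_motion P (\<lambda>t \<omega>. \<omega> (- t)) \<and>
     prob_space.indep_var P
       (PiM {0..} (\<lambda>_. borel)) (\<lambda>\<omega>. \<lambda>t\<in>{0..}. \<omega> t)
       (PiM {0..} (\<lambda>_. borel)) (\<lambda>\<omega>. \<lambda>t\<in>{0..}. \<omega> (- t))"

definition completed_wiener_measure :: "(real \<Rightarrow> real) measure \<Rightarrow> bool" where
  "completed_wiener_measure W \<longleftrightarrow> (\<exists>P. two_sided_wiener_measure P \<and> W = completion P)"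

definition levy_shift :: "real \<Rightarrow> (real \<Rightarrow> real) \<Rightarrow> (real \<Rightarrow> real)" where
  "levy_shift u \<omega> = (\<lambda>t. \<omega> (u + t) - \<omega> u)"

lemma levy_shift_in_Omega0: "\<omega> \<in> Omega0 \<Longrightarrow> levy_shift u \<omega> \<in> Omega0"
proof -
  assume "\<omega> \<in> Omega0"
  then have "continuous_on UNIV \<omega>"
    by (simp add: Omega0_def)
  then have "continuous_on UNIV (\<lambda>t. \<omega> (u + t))"
    by (rule continuous_on_compose2) (intro continuous_intros, simp)
  then have "continuous_on UNIV (\<lambda>t. \<omega> (u + t) - \<omega> u)"
    by (intro continuous_intros)
  then show ?thesis
    by (simp add: Omega0_def levy_shift_def)
qed

text \<open>\<^typ>\<open>real option\<close> is the real line with the coffin state \<^term>\<open>None\<close> adjoined.\<close>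

definition borel_coffin :: "real option measure" where
  "borel_coffin = sigma UNIV (insert {None} ((\<lambda>A. Some ` A) ` sets borel))"

definition real_values :: "(nat \<Rightarrow> real option) \<Rightarrow> real set" where
  "real_values s = {x. Some x \<in> range s}"

text \<open>A random set is a total function on \<^typ>\<open>real \<Rightarrow> real\<close>, of which only the values on
  \<^const>\<open>Omega0\<close> matter.\<close>

type_synonym random_set = "(real \<Rightarrow> real) \<Rightarrow> real set"

definition graph_of :: "random_set \<Rightarrow> ((real \<Rightarrow> real) \<times> real) set" where
  "graph_of M = {(\<omega>, t). \<omega> \<in> Omega0 \<and> t \<in> M \<omega>}"

definition random_countable_set :: "(real \<Rightarrow> real) measure \<Rightarrow> random_set \<Rightarrow> bool" where
  "random_countable_set W M \<longleftrightarrow>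
     (\<exists>S :: nat \<Rightarrow> (real \<Rightarrow> real) \<Rightarrow> real option.
        (\<forall>i. S i \<in> measurable W borel_coffin) \<and>
        (AE \<omega> in W. M \<omega> = real_values (\<lambda>i. S i \<omega>)))"

definition stationary :: "(real \<Rightarrow> real) measure \<Rightarrow> random_set \<Rightarrow> bool" where
  "stationary W M \<longleftrightarrow> (\<forall>u. AE \<omega> in W. M \<omega> = (\<lambda>t. u + t) ` M (levy_shift u \<omega>))"

definition perfectly_stationary :: "random_set \<Rightarrow> bool" where
  "perfectly_stationary M \<longleftrightarrow> (\<forall>u. \<forall>\<omega>\<in>Omega0. M \<omega> = (\<lambda>t. u + t) ` M (levy_shift u \<omega>))"

definition version_of :: "(real \<Rightarrow> real) measure \<Rightarrow> random_set \<Rightarrow> random_set \<Rightarrow> bool" where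
  "version_of W M' M \<longleftrightarrow>
     {\<omega>\<in>Omega0. M \<omega> = M' \<omega>} \<in> sets W \<and> emeasure W {\<omega>\<in>Omega0. M \<omega> = M' \<omega>} = 1"

end

theory Submission
  imports Defs
begin

text \<open>Replace \<open>M\<close> by an almost surely equal \<open>N\<close> given by a Borel enumeration, and put
  \<open>M' \<omega> = {t. t \<in> u + N (\<Delta>\<^sub>u \<omega>) for Lebesgue-almost every u}\<close>. Since \<open>\<Delta>\<^sub>u \<Delta>\<^sub>w = \<Delta>\<^sub>w\<^sub>+\<^sub>u\<close>, translation
  invariance of Lebesgue measure makes \<open>M'\<close> perfectly stationary, and its graph is measurable by
  Fubini. Setting \<open>M'\<close> to \<open>\<emptyset>\<close> off the shift-invariant Borel set of those \<open>\<omega>\<close> for which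
  \<open>u + N (\<Delta>\<^sub>u \<omega>)\<close> is the same set for almost all \<open>u\<close> makes it countable. By stationarity and
  Fubini this set has full measure and \<open>M' = N\<close> almost surely; here one needs that \<open>\<Delta>\<^sub>u\<close> preserves
  Wiener measure, in order to pass from \<open>M (\<Delta>\<^sub>u \<omega>)\<close> to \<open>N (\<Delta>\<^sub>u \<omega>)\<close>.\<close>

subsection \<open>The Borel sigma-field of path space\<close>

lemma eval_borel_measurable:
  "(\<lambda>\<omega>. \<omega> t) \<in> borel_measurable borel_Omega0"
proof (rule borel_measurableI)
  fix V :: "real set" assume V: "open V"
  have "loc_unif_open ((\<lambda>\<omega>. \<omega> t) -` V \<inter> Omega0)"
    unfolding loc_unif_open_def
  proof (intro conjI ballI)
    fix \<omega> assume "\<omega> \<in> (\<lambda>\<omega>. \<omega> t) -` V \<inter> Omega0"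
    then obtain e where "e > 0" "\<And>y. dist y (\<omega> t) < e \<Longrightarrow> y \<in> V"
      using V unfolding open_dist by (metis IntD1 vimage_eq)
    then show "\<exists>K e. compact K \<and> e > 0 \<and> {\<eta>\<in>Omega0. \<forall>s\<in>K. dist (\<eta> s) (\<omega> s) < e} \<subseteq> (\<lambda>\<omega>. \<omega> t) -` V \<inter> Omega0"
      by (intro exI[of _ "{t}"] exI[of _ e]) auto
  qed auto
  then show "(\<lambda>\<omega>. \<omega> t) -` V \<inter> space borel_Omega0 \<in> sets borel_Omega0"
    unfolding space_borel_Omega0 unfolding borel_Omega0_def
    by (subst sets_measure_of)
      (auto simp: openin_loc_unif_topology loc_unif_open_def intro!: sigma_sets.Basic)
qed

text \<open>There are only countably many finite sets of rational tubes, and by \<open>rat_tube_inside\<close> below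
  they form a base of the locally uniform topology; this replaces separability of path space.\<close>

definition rat_tube :: "(rat \<times> rat \<times> rat \<times> rat) set \<Rightarrow> (real \<Rightarrow> real) set" where
  "rat_tube L = {\<omega>\<in>Omega0. \<forall>(a, b, q, r)\<in>L. \<forall>t\<in>{of_rat a<..<of_rat b}. \<bar>\<omega> t - of_rat q\<bar> \<le> of_rat r}"

text \<open>A violation at \<open>t\<close> would persist on a neighbourhood by continuity and so
  occur at a rational time. This turns a bound over an interval into countably many
  conditions.\<close>

lemma dense_rat_bound:
  fixes f :: "real \<Rightarrow> real"
  assumes f: "continuous_on UNIV f"
    and bd: "\<And>t. t \<in> \<rat> \<Longrightarrow> a < t \<Longrightarrow> t < b \<Longrightarrow> \<bar>f t - q\<bar> \<le> r"
    and t: "a < t" "t < b"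
  shows "\<bar>f t - q\<bar> \<le> r"
proof (rule ccontr)
  assume *: "\<not> \<bar>f t - q\<bar> \<le> r"
  define V where "V = {a<..<b} \<inter> (\<lambda>s. \<bar>f s - q\<bar>) -` {r<..}"
  have "t \<in> V"
    using t * by (simp add: V_def)
  moreover have "open V"
    unfolding V_def by (intro open_Int open_vimage continuous_intros f)
  ultimately obtain e where e: "e > 0" "\<And>s. dist s t < e \<Longrightarrow> s \<in> V"
    unfolding open_dist by blast
  obtain s where "s \<in> \<rat>" "t < s" "s < t + e"
    using Rats_dense_in_real[of t "t + e"] e by auto
  with bd[of s] e(2)[of s] show False
    by (auto simp: V_def dist_real_def)
qed

lemma sets_rat_tube:
  assumes "finite L"
  shows "rat_tube L \<in> sets (restrict_space (PiM UNIV (\<lambda>_. borel)) Omega0)"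
proof -
  \<comment> \<open>The bounds in a tube are non-strict, so they hold on the whole interval as soon
    as they hold at its rational times; a strict bound would survive this passage only as a
    non-strict one.\<close>
  have "rat_tube L = {\<omega>\<in>Omega0. \<forall>(a, b, q, r)\<in>L. \<forall>t\<in>\<rat> \<inter> {of_rat a<..<of_rat b}.
     \<bar>\<omega> t - of_rat q\<bar> \<le> of_rat r}"
    unfolding rat_tube_def
  proof (intro Collect_cong conj_cong ball_cong refl, goal_cases)
    case (1 \<omega> x)
    obtain a b q r where x: "x = (a, b, q, r)"
      by (cases x) auto
    have "continuous_on UNIV \<omega>"
      using 1 by (simp add: Omega0_def)
    from dense_rat_bound[OF this, of "of_rat a" "of_rat b" "of_rat q" "of_rat r"] show ?case
      by (auto simp: x)
  qed
  also have "\<dots> = {\<omega>\<in>space (PiM UNIV (\<lambda>_. borel)). \<forall>(a, b, q, r)\<in>L. \<forall>t\<in>\<rat> \<inter> {of_rat a<..<of_rat b}.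
     \<bar>\<omega> t - of_rat q\<bar> \<le> of_rat r} \<inter> Omega0"
    by (auto simp: space_PiM)
  also have "\<dots> \<in> sets (restrict_space (PiM UNIV (\<lambda>_. borel)) Omega0)"
  proof (subst Int_commute, subst sets_restrict_space, rule imageI)
    have [measurable]: "(\<lambda>\<omega>. \<omega> t) \<in> borel_measurable (PiM UNIV (\<lambda>_. borel :: real measure))" for t :: real
      by measurable
    have "{\<omega>\<in>space (PiM UNIV (\<lambda>_. borel)). \<forall>t\<in>\<rat> \<inter> {real_of_rat a<..<of_rat b}.
     \<bar>\<omega> t - real_of_rat q\<bar> \<le> of_rat r} \<in> sets (PiM UNIV (\<lambda>_. borel))" for a b q r
      by (intro sets.sets_Collect_countable_All' countable_Int1 countable_rat) measurable
    then have "{\<omega>\<in>space (PiM UNIV (\<lambda>_. borel)). \<forall>x\<in>L. case x of (a, b, q, r) \<Rightarrow> \<forall>t\<in>\<rat> \<inter> {real_of_rat a<..<of_rat b}.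
     \<bar>\<omega> t - of_rat q\<bar> \<le> real_of_rat r} \<in> sets (PiM UNIV (\<lambda>_. borel))"
      by (intro sets.sets_Collect_countable_All' countable_finite assms) auto
    then show "{\<omega>\<in>space (PiM UNIV (\<lambda>_. borel)). \<forall>(a, b, q, r)\<in>L. \<forall>t\<in>\<rat> \<inter> {real_of_rat a<..<of_rat b}.
     \<bar>\<omega> t - of_rat q\<bar> \<le> real_of_rat r} \<in> sets (PiM UNIV (\<lambda>_. borel))"
      by simp
  qed
  finally show ?thesis .
qed

text \<open>Near each time of the compact \<open>K\<close> the path stays within a small rational
  \<open>r\<close> of a rational \<open>q\<close>. Finitely many such intervals cover
  \<open>K\<close>, and any path obeying the same bounds is within \<open>2 * r < e\<close> of
  \<open>\<omega>\<close> there.\<close>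

lemma rat_tube_inside:
  assumes "loc_unif_open U" "\<omega> \<in> U"
  shows "\<exists>L. finite L \<and> \<omega> \<in> rat_tube L \<and> rat_tube L \<subseteq> U"
proof -
  obtain K e where K: "compact K" "e > 0" "{\<eta>\<in>Omega0. \<forall>t\<in>K. dist (\<eta> t) (\<omega> t) < e} \<subseteq> U"
    using assms unfolding loc_unif_open_def by blast
  have \<omega>: "\<omega> \<in> Omega0"
    using assms by (auto simp: loc_unif_open_def)
  have rat: "\<exists>a b q r. a < t \<and> t < b \<and> (\<forall>s. a < s \<and> s < b \<longrightarrow> \<bar>\<omega> s - q\<bar> \<le> r) \<and> 2 * r < e \<and>
     a \<in> \<rat> \<and> b \<in> \<rat> \<and> q \<in> \<rat> \<and> r \<in> \<rat>" for t
  proof -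
    obtain r where r: "r \<in> \<rat>" "0 < r" "r < e / 2"
      using Rats_dense_in_real[of 0 "e / 2"] K(2) by auto
    \<comment> \<open>One half of \<open>r\<close> is spent on approximating
      \<open>\<omega> t\<close> by \<open>q\<close>, the other on the oscillation of
      \<open>\<omega>\<close> near \<open>t\<close>.\<close>
    obtain q where q: "q \<in> \<rat>" "\<omega> t - r / 2 < q" "q < \<omega> t + r / 2"
      using Rats_dense_in_real[of "\<omega> t - r / 2" "\<omega> t + r / 2"] r by auto
    have "isCont \<omega> t"
      using \<omega> by (simp add: Omega0_def continuous_on_eq_continuous_at)
    then obtain d where d: "d > 0" "\<And>s. \<bar>s - t\<bar> < d \<Longrightarrow> \<bar>\<omega> s - \<omega> t\<bar> < r / 2"
      unfolding continuous_at_eps_delta dist_real_def using r by (metis half_gt_zero)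
    obtain a where a: "a \<in> \<rat>" "t - d < a" "a < t"
      using Rats_dense_in_real[of "t - d" t] d by auto
    obtain b where b: "b \<in> \<rat>" "t < b" "b < t + d"
      using Rats_dense_in_real[of t "t + d"] d by auto
    have "\<bar>\<omega> s - q\<bar> \<le> r" if "a < s" "s < b" for s
    proof -
      have "\<bar>s - t\<bar> < d"
        using that a b by linarith
      then have "\<bar>\<omega> s - \<omega> t\<bar> < r / 2"
        by (rule d(2))
      then show ?thesis
        using q by linarith
    qed
    then show ?thesis
      using r q a b by (intro exI[of _ a] exI[of _ b] exI[of _ q] exI[of _ r]) auto
  qed
  then have "\<exists>a b q r :: rat. of_rat a < t \<and> t < of_rat b \<and>
     (\<forall>s. of_rat a < s \<and> s < of_rat b \<longrightarrow> \<bar>\<omega> s - of_rat q\<bar> \<le> of_rat r) \<and> 2 * of_rat r < e" for t :: real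
  proof -
    obtain a b q r where *: "a < t" "t < b" "\<forall>s. a < s \<and> s < b \<longrightarrow> \<bar>\<omega> s - q\<bar> \<le> r" "2 * r < e"
      and "a \<in> \<rat>" "b \<in> \<rat>" "q \<in> \<rat>" "r \<in> \<rat>"
      using rat[of t] by blast
    then obtain a' b' q' r' where "a = of_rat a'" "b = of_rat b'" "q = of_rat q'" "r = of_rat r'"
      by (auto elim!: Rats_cases)
    with * show ?thesis
      by blast
  qed
  then obtain a b q r :: "real \<Rightarrow> rat" where B: "\<And>t. of_rat (a t) < t" "\<And>t. t < of_rat (b t)"
     "\<And>t s. of_rat (a t) < s \<Longrightarrow> s < of_rat (b t) \<Longrightarrow> \<bar>\<omega> s - of_rat (q t)\<bar> \<le> of_rat (r t)"
     "\<And>t. 2 * of_rat (r t) < e"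
    by metis
  obtain T where T: "T \<subseteq> K" "finite T" "K \<subseteq> (\<Union>t\<in>T. {of_rat (a t)<..<of_rat (b t)})"
  proof (rule compactE_image[OF K(1)])
    show "K \<subseteq> (\<Union>t\<in>K. {of_rat (a t)<..<of_rat (b t)})"
      using B(1,2) by auto
  qed auto
  let ?L = "(\<lambda>t. (a t, b t, q t, r t)) ` T"
  have "\<eta> \<in> U" if \<eta>: "\<eta> \<in> rat_tube ?L" for \<eta>
  proof -
    have "dist (\<eta> s) (\<omega> s) < e" if s: "s \<in> K" for s
    proof -
      obtain t where t: "t \<in> T" "of_rat (a t) < s" "s < of_rat (b t)"
        using T s by auto
      have "\<bar>\<eta> s - of_rat (q t)\<bar> \<le> of_rat (r t)"
        using \<eta> t by (auto simp: rat_tube_def)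
      then show ?thesis
        using B(3)[OF t(2,3)] B(4)[of t] by (simp add: dist_real_def abs_le_iff abs_less_iff)
    qed
    then show ?thesis
      using \<eta> K(3) by (auto simp: rat_tube_def)
  qed
  moreover have "\<omega> \<in> rat_tube ?L"
    using \<omega> B(3) by (auto simp: rat_tube_def)
  ultimately show ?thesis
    using T(2) by (intro exI[of _ ?L]) auto
qed

text \<open>An open set is the union of the countably many rational tubes inside it, each of which
  is built from coordinates; conversely the evaluations are Borel. Hence measurability into path
  space can be checked coordinatewise and laws can be compared on cylinders.\<close>

lemma sets_borel_Omega0:
  "sets borel_Omega0 = sets (restrict_space (PiM UNIV (\<lambda>_. borel)) Omega0)" (is "_ = sets ?R")
proof (rule antisym)
  have "U \<in> sets ?R" if U: "loc_unif_open U" for U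
  proof -
    let ?C = "{L. finite L \<and> rat_tube L \<subseteq> U}"
    have "countable ?C"
      by (rule countable_subset[OF _ countable_Collect_finite]) auto
    then have "(\<Union>L\<in>?C. rat_tube L) \<in> sets ?R"
      by (intro sets.countable_UN'') (auto intro: sets_rat_tube)
    also have "(\<Union>L\<in>?C. rat_tube L) = U"
      using rat_tube_inside[OF U] by blast
    finally show ?thesis .
  qed
  then have "Collect (openin loc_unif_topology) \<subseteq> sets ?R"
    by (auto simp: openin_loc_unif_topology)
  moreover have sp: "space ?R = Omega0"
    by (simp add: space_restrict_space space_PiM)
  ultimately show "sets borel_Omega0 \<subseteq> sets ?R"
    unfolding borel_Omega0_def
    using sets.sigma_sets_subset[of "Collect (openin loc_unif_topology)" ?R]
    by (subst sets_measure_of) (auto simp: openin_loc_unif_topology loc_unif_open_def)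
  have "(\<lambda>\<omega>. \<omega>) \<in> measurable borel_Omega0 (PiM UNIV (\<lambda>_. borel))"
    by (rule measurable_PiM_single') (auto simp: eval_borel_measurable)
  then show "sets ?R \<subseteq> sets borel_Omega0"
    by (auto simp: sets_restrict_space space_borel_Omega0 Int_commute dest!: measurable_sets)
qed

lemma measurable_borel_Omega0I:
  assumes "\<And>x. x \<in> space N \<Longrightarrow> f x \<in> Omega0"
    and "\<And>t. (\<lambda>x. f x t) \<in> borel_measurable N"
  shows "f \<in> measurable N borel_Omega0"
proof -
  have "f \<in> measurable N (restrict_space (PiM UNIV (\<lambda>_. borel)) Omega0)"
    by (rule measurable_restrict_space2) (auto intro!: assms measurable_PiM_single')
  then show ?thesis
    by (simp cong: measurable_cong_sets add: sets_borel_Omega0)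
qed

section \<open>Joint measurability in path and time\<close>

text \<open>The path is evaluated at the last point of the grid of mesh \<open>1 / Suc n\<close> not
  exceeding \<open>t\<close>. These points tend to \<open>t\<close>, and continuity of the path
  gives pointwise convergence.\<close>

lemma eval_pair_measurable:
  "(\<lambda>(\<omega>, t). \<omega> t) \<in> borel_measurable (borel_Omega0 \<Otimes>\<^sub>M borel)"
proof (rule borel_measurable_LIMSEQ_real)
  let ?f = "\<lambda>n (\<omega> :: real \<Rightarrow> real, t). \<omega> (real_of_int \<lfloor>real (Suc n) * t\<rfloor> / real (Suc n))"
  show "(\<lambda>n. ?f n x) \<longlonglongrightarrow> (case x of (\<omega>, t) \<Rightarrow> \<omega> t)" if x: "x \<in> space (borel_Omega0 \<Otimes>\<^sub>M borel)" for x
  proof -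
    obtain \<omega> t where [simp]: "x = (\<omega>, t)" and \<omega>: "\<omega> \<in> Omega0"
      using x by (auto simp: space_pair_measure space_borel_Omega0)
    have "(\<lambda>n. real_of_int \<lfloor>real (Suc n) * t\<rfloor> / real (Suc n)) \<longlonglongrightarrow> t"
    proof (rule tendsto_sandwich)
      show "\<forall>\<^sub>F n in sequentially. t - 1 / real (Suc n) \<le> real_of_int \<lfloor>real (Suc n) * t\<rfloor> / real (Suc n)"
      proof (intro always_eventually allI)
        fix n
        have "real (Suc n) * t - 1 \<le> real_of_int \<lfloor>real (Suc n) * t\<rfloor>" by linarith
        then show "t - 1 / real (Suc n) \<le> real_of_int \<lfloor>real (Suc n) * t\<rfloor> / real (Suc n)"
          using divide_right_mono[of "real (Suc n) * t - 1" _ "real (Suc n)"]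
          by (simp add: diff_divide_distrib del: of_nat_Suc)
      qed
      show "\<forall>\<^sub>F n in sequentially. real_of_int \<lfloor>real (Suc n) * t\<rfloor> / real (Suc n) \<le> t"
      proof (intro always_eventually allI)
        fix n
        have "real_of_int \<lfloor>real (Suc n) * t\<rfloor> \<le> real (Suc n) * t" by linarith
        then show "real_of_int \<lfloor>real (Suc n) * t\<rfloor> / real (Suc n) \<le> t"
          by (simp add: field_simps del: of_nat_Suc)
      qed
      show "(\<lambda>n. t - 1 / real (Suc n)) \<longlonglongrightarrow> t"
        using tendsto_diff[OF tendsto_const LIMSEQ_inverse_real_of_nat, of t]
        by (simp add: inverse_eq_divide)
    qed auto
    moreover have "isCont \<omega> t"
      using \<omega> by (simp add: Omega0_def continuous_on_eq_continuous_at)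
    ultimately have "(\<lambda>n. \<omega> (real_of_int \<lfloor>real (Suc n) * t\<rfloor> / real (Suc n))) \<longlonglongrightarrow> \<omega> t"
      by (rule isCont_tendsto_compose[rotated])
    then show ?thesis
      by simp
  qed
  show "?f n \<in> borel_measurable (borel_Omega0 \<Otimes>\<^sub>M borel)" for n
  proof -
    \<comment> \<open>The grid time depends on \<open>t\<close> only through an integer
      \<open>k\<close>, so each approximant is glued from countably many evaluations at fixed
      times.\<close>
    have "(\<lambda>x. (\<lambda>(k::int) x. fst x (real_of_int k / real (Suc n))) \<lfloor>real (Suc n) * snd x\<rfloor> x)
        \<in> borel_measurable (borel_Omega0 \<Otimes>\<^sub>M (borel :: real measure))"
      by (rule measurable_compose_countable)
        (auto intro!: measurable_compose[OF measurable_fst eval_borel_measurable])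
    then show ?thesis by (simp add: case_prod_beta')
  qed
qed

text \<open>The Fubini arguments over \<open>u\<close> need measurability in path and shift
  together. The coordinate at \<open>t\<close> is a difference of two joint evaluations, at the
  times \<open>u + t\<close> and \<open>u\<close>.\<close>

lemma levy_shift_pair_measurable:
  "(\<lambda>(\<omega>, u). levy_shift u \<omega>) \<in> measurable (borel_Omega0 \<Otimes>\<^sub>M borel) borel_Omega0"
proof (rule measurable_borel_Omega0I)
  show "(case x of (\<omega>, u) \<Rightarrow> levy_shift u \<omega>) \<in> Omega0"
    if "x \<in> space (borel_Omega0 \<Otimes>\<^sub>M borel)" for x
    using that by (auto simp: space_pair_measure space_borel_Omega0 levy_shift_in_Omega0)
  have [measurable]: "(\<lambda>x. fst x (snd x + c)) \<in> borel_measurable (borel_Omega0 \<Otimes>\<^sub>M borel)" for c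
    using measurable_compose[OF _ eval_pair_measurable, of "\<lambda>x. (fst x, snd x + c)"]
    by (simp add: case_prod_beta')
  from this[of 0] have [measurable]: "(\<lambda>x. fst x (snd x)) \<in> borel_measurable (borel_Omega0 \<Otimes>\<^sub>M (borel::real measure))"
    by simp
  show "(\<lambda>x. (case x of (\<omega>, u) \<Rightarrow> levy_shift u \<omega>) t) \<in> borel_measurable (borel_Omega0 \<Otimes>\<^sub>M borel)" for t
    by (simp add: levy_shift_def case_prod_beta')
qed

subsection \<open>Shift invariance of Wiener measure\<close>

text \<open>The parameter is the variance, so that an increment over a time step of length
  \<open>h\<close> has law \<open>centered_gauss h\<close>.\<close>

definition centered_gauss :: "real \<Rightarrow> real measure" where
  "centered_gauss v = density lborel (normal_density 0 (sqrt v))"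

text \<open>The density is even and Lebesgue measure is reflection invariant. This absorbs the sign
  change of increments when the negative half-line is run backwards.\<close>

lemma measure_centered_gauss_uminus:
  assumes "A \<in> sets borel"
  shows "measure (centered_gauss v) (uminus -` A) = measure (centered_gauss v) A"
proof -
  have "emeasure (centered_gauss v) A = (\<integral>\<^sup>+x. normal_density 0 (sqrt v) x * indicator A x \<partial>lborel)"
    using assms by (simp add: centered_gauss_def emeasure_density ennreal_mult' ennreal_indicator)
  also have "\<dots> = (\<integral>\<^sup>+x. normal_density 0 (sqrt v) x * indicator A x \<partial>distr lborel borel uminus)"
    by (simp add: lborel_distr_uminus)
  also have "\<dots> = (\<integral>\<^sup>+x. normal_density 0 (sqrt v) (- x) * indicator A (- x) \<partial>lborel)"
    using assms by (subst nn_integral_distr) auto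
  also have "\<dots> = (\<integral>\<^sup>+x. normal_density 0 (sqrt v) x * indicator (uminus -` A) x \<partial>lborel)"
    by (simp add: normal_density_def indicator_vimage comp_def)
  also have "\<dots> = emeasure (centered_gauss v) (uminus -` A)"
    using measurable_sets[OF borel_measurable_uminus[OF measurable_ident_sets[OF refl]] assms]
    by (simp add: centered_gauss_def emeasure_density ennreal_mult' ennreal_indicator)
  finally show ?thesis
    by (simp add: measure_def)
qed

lemma brownian_increments_box:
  assumes X: "standard_brownian_motion P X"
    and \<tau>: "\<forall>i\<le>n. 0 \<le> \<tau> i" "\<forall>i<n. \<tau> i < \<tau> (Suc i)"
    and A: "\<And>i. i < n \<Longrightarrow> A i \<in> sets borel"
  shows "measure P {\<omega>\<in>space P. \<forall>i<n. X (\<tau> (Suc i)) \<omega> - X (\<tau> i) \<omega> \<in> A i} =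
    (\<Prod>i<n. measure (centered_gauss (\<tau> (Suc i) - \<tau> i)) (A i))"
proof -
  interpret prob_space P
    using X by (simp add: standard_brownian_motion_def)
  show ?thesis
  \<comment> \<open>The product rule for independence asks for a nonempty index set, and an empty
    intersection would be \<open>UNIV\<close> rather than \<open>space P\<close>.\<close>
  proof (cases "n = 0")
    case True
    then show ?thesis by (simp add: prob_space)
  next
    case False
    let ?D = "\<lambda>i \<omega>. X (\<tau> (Suc i)) \<omega> - X (\<tau> i) \<omega>"
    have ind: "indep_vars (\<lambda>_. borel) ?D {..<n}"
      using X \<tau> unfolding standard_brownian_motion_def by simp
    have "{\<omega>\<in>space P. \<forall>i<n. ?D i \<omega> \<in> A i} = (\<Inter>i\<in>{..<n}. ?D i -` A i \<inter> space P)"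
      using False by auto
    then have "prob {\<omega>\<in>space P. \<forall>i<n. ?D i \<omega> \<in> A i} = (\<Prod>i<n. prob (?D i -` A i \<inter> space P))"
      using indep_varsD[OF ind, of "{..<n}" A] False A by (simp add: lessThan_empty_iff)
    also have "\<dots> = (\<Prod>i<n. measure (centered_gauss (\<tau> (Suc i) - \<tau> i)) (A i))"
    proof (rule prod.cong[OF refl])
      fix i assume "i \<in> {..<n}"
      then have "i < n" by simp
      have "distributed P lborel (?D i) (normal_density 0 (sqrt (\<tau> (Suc i) - \<tau> i)))"
        using X \<tau> \<open>i < n\<close> unfolding standard_brownian_motion_def by simp
      then have "distr P lborel (?D i) = centered_gauss (\<tau> (Suc i) - \<tau> i)"
        "?D i \<in> measurable P lborel"
        by (auto simp: distributed_def centered_gauss_def)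
      then show "prob (?D i -` A i \<inter> space P) = measure (centered_gauss (\<tau> (Suc i) - \<tau> i)) (A i)"
        using A[OF \<open>i < n\<close>] measure_distr[of "?D i" P lborel "A i"] by simp
    qed
    finally show ?thesis .
  qed
qed

text \<open>The grid passes through \<open>0\<close> at index \<open>k\<close>: steps from
  \<open>k\<close> on belong to the forward motion, earlier ones to the backward motion.
  Independence of the two halves multiplies the two products.\<close>

lemma wiener_increments_box:
  assumes P: "two_sided_wiener_measure P"
    and \<tau>: "\<forall>i<n. \<tau> i < \<tau> (Suc i)" "k \<le> n" "\<tau> k = 0"
    and A: "\<And>i. i < n \<Longrightarrow> A i \<in> sets borel"
  shows "measure P {\<omega>\<in>space P. \<forall>i<n. \<omega> (\<tau> (Suc i)) - \<omega> (\<tau> i) \<in> A i} =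
    (\<Prod>i<n. measure (centered_gauss (\<tau> (Suc i) - \<tau> i)) (A i))"
proof -
  interpret prob_space P
    using P by (simp add: two_sided_wiener_measure_def)
  have mono: "\<tau> i \<le> \<tau> j" if "i \<le> j" "j \<le> n" for i j
    using that
  proof (induction j rule: dec_induct)
    case (step m)
    then have "\<tau> i \<le> \<tau> m" "\<tau> m < \<tau> (Suc m)"
      using \<tau>(1) by auto
    then show ?case
      by simp
  qed simp
  \<comment> \<open>\<open>Xp\<close> and \<open>Xm\<close> express the two groups of conditions as
    events for the half-line processes; in \<open>Xm\<close> the argument \<open>f\<close> is the
    backward path, whence the negated times.\<close>
  define Xp where "Xp = {f\<in>space (PiM {0::real..} (\<lambda>_. borel)). \<forall>i\<in>{k..<n}. f (\<tau> (Suc i)) - f (\<tau> i) \<in> A i}"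
  define Xm where "Xm = {f\<in>space (PiM {0::real..} (\<lambda>_. borel)). \<forall>i\<in>{..<k}. f (- \<tau> (Suc i)) - f (- \<tau> i) \<in> A i}"
  have pos: "0 \<le> \<tau> i" if "k \<le> i" "i \<le> n" for i
    using mono[OF that] \<tau>(3) by simp
  have neg: "\<tau> i \<le> 0" if "i \<le> k" for i
    using mono[OF that \<tau>(2)] \<tau>(3) by simp
  have "Xp \<in> sets (PiM {0..} (\<lambda>_. borel))"
    unfolding Xp_def using pos A
    by (intro sets.sets_Collect_finite_All measurable_sets_Collect[OF borel_measurable_diff] measurable_component_singleton) auto
  moreover have "Xm \<in> sets (PiM {0..} (\<lambda>_. borel))"
    unfolding Xm_def using neg A \<tau>(2)
    by (intro sets.sets_Collect_finite_All measurable_sets_Collect[OF borel_measurable_diff] measurable_component_singleton) auto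
  ultimately have ind: "prob ((\<lambda>\<omega>. (\<lambda>t\<in>{0..}. \<omega> t, \<lambda>t\<in>{0..}. \<omega> (- t))) -` (Xp \<times> Xm) \<inter> space P) =
     prob ((\<lambda>\<omega>. \<lambda>t\<in>{0..}. \<omega> t) -` Xp \<inter> space P) * prob ((\<lambda>\<omega>. \<lambda>t\<in>{0..}. \<omega> (- t)) -` Xm \<inter> space P)"
    using P unfolding two_sided_wiener_measure_def by (intro indep_varD) auto
  have setp: "(\<lambda>\<omega>. \<lambda>t\<in>{0..}. \<omega> t) -` Xp \<inter> space P =
     {\<omega>\<in>space P. \<forall>i\<in>{k..<n}. \<omega> (\<tau> (Suc i)) - \<omega> (\<tau> i) \<in> A i}"
    using pos by (auto simp: Xp_def space_PiM)
  have setm: "(\<lambda>\<omega>. \<lambda>t\<in>{0..}. \<omega> (- t)) -` Xm \<inter> space P =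
     {\<omega>\<in>space P. \<forall>i\<in>{..<k}. \<omega> (\<tau> (Suc i)) - \<omega> (\<tau> i) \<in> A i}"
    using neg by (auto simp: Xm_def space_PiM)
  have split: "{..<n} = {k..<n} \<union> {..<k}" "{k..<n} \<inter> {..<k} = {}"
    using \<tau>(2) by auto
  have setpm: "(\<lambda>\<omega>. (\<lambda>t\<in>{0..}. \<omega> t, \<lambda>t\<in>{0..}. \<omega> (- t))) -` (Xp \<times> Xm) \<inter> space P =
      {\<omega>\<in>space P. \<forall>i\<in>{..<n}. \<omega> (\<tau> (Suc i)) - \<omega> (\<tau> i) \<in> A i}"
    using setp setm unfolding split(1) by blast

  have "{\<omega>\<in>space P. \<forall>i\<in>{k..<n}. \<omega> (\<tau> (Suc i)) - \<omega> (\<tau> i) \<in> A i} =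
      {\<omega>\<in>space P. \<forall>i\<in>(\<lambda>i. k + i) ` {..<n - k}. \<omega> (\<tau> (Suc i)) - \<omega> (\<tau> i) \<in> A i}"
    using \<tau>(2) by (simp add: lessThan_atLeast0 add.commute[of k])
  also have "\<dots> = {\<omega>\<in>space P. \<forall>i<n - k. \<omega> (\<tau> (k + Suc i)) - \<omega> (\<tau> (k + i)) \<in> A (k + i)}"
    by (intro Collect_cong conj_cong refl) auto
  also have "prob \<dots> = (\<Prod>i<n - k. measure (centered_gauss (\<tau> (k + Suc i) - \<tau> (k + i))) (A (k + i)))"
    using brownian_increments_box[of P "\<lambda>t \<omega>. \<omega> t" "n - k" "\<lambda>i. \<tau> (k + i)" "\<lambda>i. A (k + i)"] P \<tau> pos A
    unfolding two_sided_wiener_measure_def by auto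
  also have "\<dots> = (\<Prod>i\<in>{k..<n}. measure (centered_gauss (\<tau> (Suc i) - \<tau> i)) (A i))"
    by (rule prod.reindex_bij_witness[of _ "\<lambda>i. i - k" "\<lambda>i. k + i"]) auto
  finally have probp: "prob {\<omega>\<in>space P. \<forall>i\<in>{k..<n}. \<omega> (\<tau> (Suc i)) - \<omega> (\<tau> i) \<in> A i} =
     (\<Prod>i\<in>{k..<n}. measure (centered_gauss (\<tau> (Suc i) - \<tau> i)) (A i))" .

  have rev: "{..<k} = (\<lambda>i. k - Suc i) ` {..<k}"
  proof (intro equalityI subsetI)
    fix i assume "i \<in> {..<k}"
    then have "i = k - Suc (k - Suc i)" "k - Suc i \<in> {..<k}"
      by auto
    then show "i \<in> (\<lambda>i. k - Suc i) ` {..<k}"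
      by (rule image_eqI)
  qed auto
  have Suc: "Suc (k - Suc i) = k - i" if "i < k" for i
    using that by simp
  have "{\<omega>\<in>space P. \<forall>i\<in>{..<k}. \<omega> (\<tau> (Suc i)) - \<omega> (\<tau> i) \<in> A i} =
     {\<omega>\<in>space P. \<forall>i\<in>(\<lambda>i. k - Suc i) ` {..<k}. \<omega> (\<tau> (Suc i)) - \<omega> (\<tau> i) \<in> A i}"
    using rev by simp
  \<comment> \<open>The times \<open>- \<tau> (k - i)\<close> start at \<open>0\<close> and increase
    with \<open>i\<close>. The backward increment number \<open>i\<close> is minus the original
    increment number \<open>k - Suc i\<close>, so the target set is reflected.\<close>
  also have "\<dots> = {\<omega>\<in>space P. \<forall>i<k. \<omega> (- (- \<tau> (k - Suc i))) - \<omega> (- (- \<tau> (k - i))) \<in> uminus -` A (k - Suc i)}"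
    by (intro Collect_cong conj_cong refl) (auto simp: Suc)
  also have "prob \<dots> = (\<Prod>i<k. measure (centered_gauss (- \<tau> (k - Suc i) - - \<tau> (k - i))) (uminus -` A (k - Suc i)))"
  proof (rule brownian_increments_box[of P "\<lambda>t \<omega>. \<omega> (- t)" k "\<lambda>i. - \<tau> (k - i)" "\<lambda>i. uminus -` A (k - Suc i)"])
    show "standard_brownian_motion P (\<lambda>t \<omega>. \<omega> (- t))"
      using P by (simp add: two_sided_wiener_measure_def)
    show "\<forall>i<k. - \<tau> (k - i) < - \<tau> (k - Suc i)"
    proof (intro allI impI)
      fix i assume "i < k"
      then have "\<tau> (k - Suc i) < \<tau> (Suc (k - Suc i))"
        using \<tau>(2) by (intro \<tau>(1)[rule_format]) simp
      then show "- \<tau> (k - i) < - \<tau> (k - Suc i)"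
        using \<open>i < k\<close> by (simp add: Suc)
    qed
    show "uminus -` A (k - Suc i) \<in> sets borel" if "i < k" for i
      using measurable_sets[OF borel_measurable_uminus[OF measurable_ident_sets[OF refl]] A, of "k - Suc i"]
        that \<tau>(2) by auto
  qed (use neg in auto)
  also have "\<dots> = (\<Prod>i<k. measure (centered_gauss (\<tau> (k - i) - \<tau> (k - Suc i))) (A (k - Suc i)))"
    using \<tau>(2) by (intro prod.cong refl) (simp add: measure_centered_gauss_uminus A)
  also have "\<dots> = (\<Prod>i<k. measure (centered_gauss (\<tau> (Suc i) - \<tau> i)) (A i))"
    by (rule prod.reindex_bij_witness[of _ "\<lambda>i. k - Suc i" "\<lambda>i. k - Suc i"]) (auto simp: Suc)
  finally have probm: "prob {\<omega>\<in>space P. \<forall>i\<in>{..<k}. \<omega> (\<tau> (Suc i)) - \<omega> (\<tau> i) \<in> A i} =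
     (\<Prod>i<k. measure (centered_gauss (\<tau> (Suc i) - \<tau> i)) (A i))" .

  have "prob {\<omega>\<in>space P. \<forall>i\<in>{..<n}. \<omega> (\<tau> (Suc i)) - \<omega> (\<tau> i) \<in> A i} =
    (\<Prod>i\<in>{k..<n}. measure (centered_gauss (\<tau> (Suc i) - \<tau> i)) (A i)) *
    (\<Prod>i<k. measure (centered_gauss (\<tau> (Suc i) - \<tau> i)) (A i))"
    using ind unfolding setp setm setpm probp probm .
  also have "\<dots> = (\<Prod>i<n. measure (centered_gauss (\<tau> (Suc i) - \<tau> i)) (A i))"
    unfolding split(1) by (rule prod.union_disjoint[symmetric]) (use split(2) in auto)
  finally show ?thesis
    by (simp add: lessThan_def)
qed

section \<open>From increments to cylinders and to the law of the shifted path\<close>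

text \<open>Both sums telescope and at most one of them is nonempty, so values on either side of the
  base index \<open>k\<close> are recovered from increments by a single formula.\<close>

lemma diff_eq_sum_increments:
  fixes f :: "nat \<Rightarrow> real"
  shows "f j - f k = (\<Sum>i\<in>{k..<j}. f (Suc i) - f i) - (\<Sum>i\<in>{j..<k}. f (Suc i) - f i)"
  by (cases "k \<le> j") (auto simp: sum_Suc_diff')

lemma sets_wiener: "two_sided_wiener_measure P \<Longrightarrow> sets P = sets borel_Omega0"
  by (simp add: two_sided_wiener_measure_def)

text \<open>Both grids, \<open>\<tau>\<close> and \<open>u + \<tau>\<close>, must contain \<open>0\<close>, since only there independence of the increments
  can be read off from the definition of the two-sided measure.\<close>

lemma wiener_increments_distr_shift:
  assumes P: "two_sided_wiener_measure P"
    and \<tau>: "\<forall>i<n. \<tau> i < \<tau> (Suc i)" "k \<le> n" "\<tau> k = 0" "l \<le> n" "u + \<tau> l = 0"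
  shows "distr P (PiM {..<n} (\<lambda>_. borel)) (\<lambda>\<omega>. \<lambda>i\<in>{..<n}. \<omega> (\<tau> (Suc i)) - \<omega> (\<tau> i)) =
    distr P (PiM {..<n} (\<lambda>_. borel)) (\<lambda>\<omega>. \<lambda>i\<in>{..<n}. \<omega> (u + \<tau> (Suc i)) - \<omega> (u + \<tau> i))"
proof -
  interpret prob_space P
    using P by (simp add: two_sided_wiener_measure_def)
  have ev: "(\<lambda>\<omega>. \<omega> t) \<in> borel_measurable P" for t
    using eval_borel_measurable[of t] measurable_cong_sets[OF sets_wiener[OF P] refl] by blast
  define D where "D \<sigma> \<omega> = (\<lambda>i\<in>{..<n}. \<omega> (\<sigma> (Suc i)) - \<omega> (\<sigma> i))" for \<sigma> :: "nat \<Rightarrow> real" and \<omega> :: "real \<Rightarrow> real"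
  have mD: "D \<sigma> \<in> measurable P (PiM {..<n} (\<lambda>_. borel))" for \<sigma>
    unfolding D_def[abs_def] by (rule measurable_restrict) (rule borel_measurable_diff[OF ev ev])
  have fin: "emeasure (distr P (PiM {..<n} (\<lambda>_. borel)) (D \<tau>)) X \<noteq> \<infinity>" for X
    using finite_measure.emeasure_finite[OF finite_measure_distr[OF mD]] by simp
  have box: "emeasure (distr P (PiM {..<n} (\<lambda>_. borel)) (D \<sigma>)) (Pi\<^sub>E {..<n} A) =
      ennreal (measure P {\<omega>\<in>space P. \<forall>i<n. \<omega> (\<sigma> (Suc i)) - \<omega> (\<sigma> i) \<in> A i})"
    if "\<And>i. i \<in> {..<n} \<Longrightarrow> A i \<in> sets borel" for \<sigma> :: "nat \<Rightarrow> real" and A :: "nat \<Rightarrow> real set"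
  proof -
    have "D \<sigma> -` Pi\<^sub>E {..<n} A \<inter> space P = {\<omega>\<in>space P. \<forall>i<n. \<omega> (\<sigma> (Suc i)) - \<omega> (\<sigma> i) \<in> A i}"
      by (simp add: D_def vimage_def Int_def conj_commute restrict_PiE_iff Ball_def Pi_iff)
    moreover have "Pi\<^sub>E {..<n} A \<in> sets (PiM {..<n} (\<lambda>_. borel))"
      using that by (intro sets_PiM_I_finite) auto
    ultimately show ?thesis
      using emeasure_distr[OF mD, of "Pi\<^sub>E {..<n} A" \<sigma>] by (simp only: emeasure_eq_measure)
  qed
  have "distr P (PiM {..<n} (\<lambda>_. borel)) (D \<tau>) = distr P (PiM {..<n} (\<lambda>_. borel)) (D (\<lambda>i. u + \<tau> i))"
  proof (rule measure_eqI_PiM_finite[where A = "\<lambda>_. space (PiM {..<n} (\<lambda>_. borel))" and M = "\<lambda>_. borel" and I = "{..<n}"])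
    fix A :: "nat \<Rightarrow> real set" assume A: "\<And>i. i \<in> {..<n} \<Longrightarrow> A i \<in> sets borel"
    have b: "emeasure (distr P (PiM {..<n} (\<lambda>_. borel)) (D \<sigma>)) (Pi\<^sub>E {..<n} A) =
      ennreal (measure P {\<omega>\<in>space P. \<forall>i<n. \<omega> (\<sigma> (Suc i)) - \<omega> (\<sigma> i) \<in> A i})" for \<sigma>
      by (rule box) (rule A)
    \<comment> \<open>Each box probability is a product of Gaussian measures that depend only on the
      step lengths, and translating the grid by \<open>u\<close> leaves these unchanged.\<close>
    show "emeasure (distr P (PiM {..<n} (\<lambda>_. borel)) (D \<tau>)) (Pi\<^sub>E {..<n} A) =
      emeasure (distr P (PiM {..<n} (\<lambda>_. borel)) (D (\<lambda>i. u + \<tau> i))) (Pi\<^sub>E {..<n} A)"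
      using wiener_increments_box[where A = A, OF P \<tau>(1-3)] A
        wiener_increments_box[where A = A and \<tau> = "\<lambda>i. u + \<tau> i", OF P _ \<tau>(4,5)] \<tau>(1)
      unfolding b by simp
  next
    have "space (PiM {..<n} (\<lambda>_. borel :: real measure)) \<in> prod_algebra {..<n} (\<lambda>_. borel)"
      unfolding space_PiM by (rule prod_algebraI_finite) auto
    then show "range (\<lambda>_. space (PiM {..<n} (\<lambda>_. borel))) \<subseteq> prod_algebra {..<n} (\<lambda>_. borel :: real measure)"
      by blast
  qed (simp_all add: fin[unfolded infinity_ennreal_def])
  then show ?thesis
    by (simp add: D_def[abs_def])
qed

text \<open>Sorting the finite set gives the grid. With \<open>n\<close> steps it has
  \<open>n + 1\<close> points, hence \<open>n = card F - 1\<close>, a true predecessor because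
  \<open>F\<close> is nonempty.\<close>

lemma strict_grid_exists:
  fixes F :: "real set"
  assumes "finite F" "F \<noteq> {}"
  obtains \<tau> n where "\<forall>i<n. \<tau> i < \<tau> (Suc i)" "\<tau> ` {..n} = F"
proof -
  let ?xs = "sorted_list_of_set F"
  have len: "length ?xs = Suc (card F - 1)"
    using assms by (simp add: card_gt_0_iff)
  show thesis
  proof (rule that[of "card F - 1" "\<lambda>i. ?xs ! i"])
    show "\<forall>i<card F - 1. ?xs ! i < ?xs ! Suc i"
      using len by (auto intro!: sorted_wrt_nth_less[OF strict_sorted_list_of_set])
    have "(\<lambda>i. ?xs ! i) ` {..card F - 1} = set ?xs"
      unfolding set_conv_nth len by (auto simp: less_Suc_eq_le)
    then show "(\<lambda>i. ?xs ! i) ` {..card F - 1} = F"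
      using assms by simp
  qed
qed

text \<open>Both events are the same condition on the increments along a grid,
  \<open>u + \<tau>\<close> for the shifted path and \<open>\<tau>\<close> for the original one, and
  these increments have the same joint law.\<close>

lemma wiener_cylinder_shift:
  assumes P: "two_sided_wiener_measure P"
    and J: "finite J" and A: "\<And>t. t \<in> J \<Longrightarrow> A t \<in> sets borel"
  shows "emeasure P {\<omega>\<in>space P. \<forall>t\<in>J. levy_shift u \<omega> t \<in> A t} =
    emeasure P {\<omega>\<in>space P. \<forall>t\<in>J. \<omega> t \<in> A t}"
proof -
  have sp: "space P = Omega0"
    using sets_eq_imp_space_eq[OF sets_wiener[OF P]] by (simp add: space_borel_Omega0)
  have ev: "(\<lambda>\<omega>. \<omega> t) \<in> borel_measurable P" for t
    using eval_borel_measurable[of t] measurable_cong_sets[OF sets_wiener[OF P] refl] by blast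
  \<comment> \<open>Besides \<open>J\<close> the grid contains the base time \<open>0\<close>, and
    \<open>- u\<close> so that the translated grid passes through \<open>0\<close> as well.\<close>
  obtain \<tau> n where \<tau>: "\<forall>i<n. \<tau> i < \<tau> (Suc i)" "\<tau> ` {..n} = insert 0 (insert (- u) J)"
  proof (rule strict_grid_exists)
    show "finite (insert 0 (insert (- u) J))"
      using J by simp
  qed auto
  have "\<exists>j\<le>n. \<tau> j = t" if "t \<in> insert 0 (insert (- u) J)" for t
    using that unfolding \<tau>(2)[symmetric] by auto
  then obtain j where j: "\<And>t. t \<in> insert 0 (insert (- u) J) \<Longrightarrow> j t \<le> n \<and> \<tau> (j t) = t"
    by metis
  define D where "D \<sigma> \<omega> = (\<lambda>i\<in>{..<n}. \<omega> (\<sigma> (Suc i)) - \<omega> (\<sigma> i))" for \<sigma> :: "nat \<Rightarrow> real" and \<omega> :: "real \<Rightarrow> real"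
  have mD: "D \<sigma> \<in> measurable P (PiM {..<n} (\<lambda>_. borel))" for \<sigma>
    unfolding D_def[abs_def] by (rule measurable_restrict) (rule borel_measurable_diff[OF ev ev])
  \<comment> \<open>\<open>g t\<close> sums the increments between the index \<open>j 0\<close> of
    time \<open>0\<close> and the index \<open>j t\<close> of \<open>t\<close>, counted negatively
    when \<open>t\<close> lies before \<open>0\<close>.\<close>
  define g where "g t d = (\<Sum>i\<in>{j 0..<j t}. d i) - (\<Sum>i\<in>{j t..<j 0}. d i)" for t and d :: "nat \<Rightarrow> real"
  define X where "X = {d\<in>space (PiM {..<n} (\<lambda>_. borel)). \<forall>t\<in>J. g t d \<in> A t}"
  have g: "g t (D \<sigma> \<omega>) = \<omega> (\<sigma> (j t)) - \<omega> (\<sigma> (j 0))" if "t \<in> J" for t \<sigma> \<omega>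
    using j[of t] j[of 0] that
    by (subst diff_eq_sum_increments[of "\<lambda>i. \<omega> (\<sigma> i)"]) (auto simp: g_def D_def intro!: arg_cong2[where f = minus] sum.cong)
  have X: "X \<in> sets (PiM {..<n} (\<lambda>_. borel))"
    unfolding X_def g_def using A j J
    by (intro sets.sets_Collect_finite_All measurable_sets_Collect[OF borel_measurable_diff]
        borel_measurable_sum measurable_component_singleton) (auto dest: order.strict_trans2)
  \<comment> \<open>The base value subtracted in \<open>g\<close> is \<open>\<omega> 0 = 0\<close>
    along \<open>\<tau>\<close> and \<open>\<omega> u\<close> along \<open>u + \<tau>\<close>; the
    latter produces exactly the Levy shift.\<close>
  have "D \<tau> -` X \<inter> space P = {\<omega>\<in>space P. \<forall>t\<in>J. \<omega> t \<in> A t}"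
    using j measurable_space[OF mD] by (auto simp: X_def g sp Omega0_def)
  moreover have "D (\<lambda>i. u + \<tau> i) -` X \<inter> space P = {\<omega>\<in>space P. \<forall>t\<in>J. levy_shift u \<omega> t \<in> A t}"
    using j measurable_space[OF mD] by (auto simp: X_def g levy_shift_def)
  moreover have "distr P (PiM {..<n} (\<lambda>_. borel)) (D \<tau>) = distr P (PiM {..<n} (\<lambda>_. borel)) (D (\<lambda>i. u + \<tau> i))"
    unfolding D_def[abs_def]
    by (rule wiener_increments_distr_shift[OF P \<tau>(1), of "j 0" "j (- u)"]) (use j in auto)
  ultimately show ?thesis
    using emeasure_distr[OF mD X] by metis
qed

lemma levy_shift_measurable: "levy_shift u \<in> measurable borel_Omega0 borel_Omega0"
proof (rule measurable_borel_Omega0I)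
  show "(\<lambda>\<omega>. levy_shift u \<omega> t) \<in> borel_measurable borel_Omega0" for t
    unfolding levy_shift_def by (intro borel_measurable_diff eval_borel_measurable)
qed (simp add: levy_shift_in_Omega0 space_borel_Omega0)

text \<open>Cylinders determine a finite measure on the product space, so the two laws agree there;
  they then agree on path space because its Borel sets are traces of product-measurable
  sets.\<close>

lemma distr_wiener_levy_shift:
  assumes P: "two_sided_wiener_measure P"
  shows "distr P borel_Omega0 (levy_shift u) = P"
proof -
  interpret prob_space P
    using P by (simp add: two_sided_wiener_measure_def)
  note sets = sets_wiener[OF P]
  have sp: "space P = Omega0"
    using sets_eq_imp_space_eq[OF sets] by (simp add: space_borel_Omega0)
  let ?\<Pi> = "PiM UNIV (\<lambda>_. borel) :: (real \<Rightarrow> real) measure"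
  have "(\<lambda>\<omega>. \<omega>) \<in> measurable borel_Omega0 ?\<Pi>"
    by (rule measurable_PiM_single') (auto simp: eval_borel_measurable)
  then have m1: "(\<lambda>\<omega>. \<omega>) \<in> measurable P ?\<Pi>"
    using measurable_cong_sets[OF sets refl] by blast
  have ms: "levy_shift u \<in> measurable P borel_Omega0"
    using levy_shift_measurable measurable_cong_sets[OF sets refl] by blast
  then have ms': "levy_shift u \<in> measurable P P"
    using measurable_cong_sets[OF refl sets] by blast
  have m2: "levy_shift u \<in> measurable P ?\<Pi>"
    using measurable_compose[OF ms' m1] by simp
  have eq: "distr P ?\<Pi> (\<lambda>\<omega>. \<omega>) = distr P ?\<Pi> (levy_shift u)"
  proof (rule measure_eqI_PiM_infinite)
    interpret Q: prob_space "distr P ?\<Pi> (\<lambda>\<omega>. \<omega>)"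
      by (rule prob_space_distr) (rule m1)
    show "finite_measure (distr P ?\<Pi> (\<lambda>\<omega>. \<omega>))"
      by unfold_locales
    fix A :: "real \<Rightarrow> real set" and J :: "real set"
    assume J: "finite J" and A: "\<And>i. i \<in> J \<Longrightarrow> A i \<in> sets borel"
    have emb: "prod_emb UNIV (\<lambda>_. borel) J (Pi\<^sub>E J A) = {\<omega>. \<forall>t\<in>J. \<omega> t \<in> A t}"
      by (auto simp: prod_emb_def PiE_iff)
    have "prod_emb UNIV (\<lambda>_. borel) J (Pi\<^sub>E J A) \<in> sets ?\<Pi>"
      using J A by (intro sets_PiM_I) auto
    then show "emeasure (distr P ?\<Pi> (\<lambda>\<omega>. \<omega>)) (prod_emb UNIV (\<lambda>_. borel) J (Pi\<^sub>E J A)) =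
      emeasure (distr P ?\<Pi> (levy_shift u)) (prod_emb UNIV (\<lambda>_. borel) J (Pi\<^sub>E J A))"
      using wiener_cylinder_shift[OF P J A, where u = u]
      by (simp add: emeasure_distr m1 m2 emb vimage_def Int_def conj_commute)
  qed auto
  show ?thesis
  proof (rule measure_eqI)
    fix B assume "B \<in> sets (distr P borel_Omega0 (levy_shift u))"
    then obtain C where C: "C \<in> sets ?\<Pi>" "B = Omega0 \<inter> C"
      by (auto simp: sets_borel_Omega0 sets_restrict_space)
    have B: "B \<in> sets borel_Omega0"
      using C by (auto simp: sets_borel_Omega0 sets_restrict_space)
    have "emeasure (distr P borel_Omega0 (levy_shift u)) B = emeasure P (levy_shift u -` C \<inter> space P)"
      using ms B measurable_space[OF ms] by (subst emeasure_distr) (auto simp: C sp space_borel_Omega0 levy_shift_in_Omega0 intro!: arg_cong[where f = "emeasure P"])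
    also have "\<dots> = emeasure (distr P ?\<Pi> (levy_shift u)) C"
      using m2 C by (simp add: emeasure_distr)
    also have "\<dots> = emeasure P B"
      using m1 C by (simp add: eq[symmetric] emeasure_distr sp Int_commute)
    finally show "emeasure (distr P borel_Omega0 (levy_shift u)) B = emeasure P B" .
  qed (simp add: sets)
qed

subsection \<open>Perfection\<close>

lemma borel_coffin_sets:
  "{None} \<in> sets borel_coffin" "A \<in> sets borel \<Longrightarrow> Some ` A \<in> sets borel_coffin"
  unfolding borel_coffin_def by (auto intro!: sigma_sets.Basic simp: sets_measure_of)

lemma space_borel_coffin: "space borel_coffin = UNIV"
  unfolding borel_coffin_def by (rule space_measure_of) auto

text \<open>\<open>None\<close> receives the default value \<open>0\<close>. A separate indicator
  will record which entries are real, so that the default is not mistaken for a point.\<close>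

lemma borel_coffin_value_measurable:
  "(\<lambda>s. case s of None \<Rightarrow> 0 | Some x \<Rightarrow> x) \<in> borel_measurable borel_coffin" (is "?f \<in> _")
proof (rule measurableI)
  fix A :: "real set" assume A: "A \<in> sets borel"
  have "?f -` A \<inter> space borel_coffin = Some ` A \<union> (if 0 \<in> A then {None} else {})"
    by (auto simp: space_borel_coffin image_iff split: option.splits)
  also have "\<dots> \<in> sets borel_coffin"
    by (intro sets.Un borel_coffin_sets(2)[OF A]) (simp add: borel_coffin_sets(1))
  finally show "?f -` A \<inter> space borel_coffin \<in> sets borel_coffin" .
qed simp

text \<open>Each \<open>S i\<close> is split into a real value and the indicator of not being
  \<open>None\<close>. Real functions measurable for the completion agree almost everywhere with
  Borel ones, and countably many exceptional null sets may be discarded together.\<close>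

lemma random_countable_set_borel_version:
  assumes "random_countable_set (completion P) M"
  shows "\<exists>(v :: nat \<Rightarrow> (real \<Rightarrow> real) \<Rightarrow> real) (d :: nat \<Rightarrow> (real \<Rightarrow> real) \<Rightarrow> real).
    (\<forall>i. v i \<in> borel_measurable P) \<and> (\<forall>i. d i \<in> borel_measurable P) \<and>
    (AE \<omega> in P. M \<omega> = {v i \<omega> | i. d i \<omega> \<noteq> 0})"
proof -
  obtain S where S: "\<And>i. S i \<in> measurable (completion P) borel_coffin"
    and M: "AE \<omega> in completion P. M \<omega> = real_values (\<lambda>i. S i \<omega>)"
    using assms unfolding random_countable_set_def by blast
  let ?val = "\<lambda>s. case s of None \<Rightarrow> 0 | Some x \<Rightarrow> (x :: real)"
  have "\<exists>g\<in>borel_measurable P. AE \<omega> in P. ?val (S i \<omega>) = g \<omega>" for i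
    using measurable_compose[OF S borel_coffin_value_measurable]
    by (rule completion_ex_borel_measurable_real)
  then obtain v where v: "\<And>i. v i \<in> borel_measurable P" "\<And>i. AE \<omega> in P. ?val (S i \<omega>) = v i \<omega>"
    by metis
  have "(indicator (- {None}) :: _ \<Rightarrow> real) \<in> borel_measurable borel_coffin"
    using sets.compl_sets[OF borel_coffin_sets(1)]
    by (intro borel_measurable_indicator) (simp add: space_borel_coffin Compl_eq_Diff_UNIV)
  then have "\<exists>g\<in>borel_measurable P. AE \<omega> in P. indicator (- {None}) (S i \<omega>) = (g \<omega> :: real)" for i
    by (intro completion_ex_borel_measurable_real measurable_compose[OF S])
  then obtain d :: "nat \<Rightarrow> (real \<Rightarrow> real) \<Rightarrow> real" where d: "\<And>i. d i \<in> borel_measurable P"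
    "\<And>i. AE \<omega> in P. indicator (- {None}) (S i \<omega>) = d i \<omega>"
    by metis
  have "AE \<omega> in P. \<forall>i. ?val (S i \<omega>) = v i \<omega> \<and> indicator (- {None}) (S i \<omega>) = d i \<omega>"
    using v(2) d(2) by (simp add: AE_all_countable)
  moreover have "AE \<omega> in P. M \<omega> = real_values (\<lambda>i. S i \<omega>)"
    using M by (simp add: AE_completion_iff)
  ultimately have "AE \<omega> in P. M \<omega> = {v i \<omega> | i. d i \<omega> \<noteq> 0}"
  proof eventually_elim
    case (elim \<omega>)
    have "Some x = S i \<omega> \<longleftrightarrow> x = v i \<omega> \<and> d i \<omega> \<noteq> 0" for x i
      using elim(1)[rule_format, of i] by (cases "S i \<omega>") (auto simp: indicator_def)
    then show ?case
      unfolding elim(2) real_values_def image_iff by auto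
  qed
  with v(1) d(1) show ?thesis
    by (intro exI[of _ v] exI[of _ d]) simp
qed

section \<open>Almost-everywhere quantifiers and versions\<close>

text \<open>The measure of the section of the exceptional set depends measurably on
  \<open>x\<close>, and the condition says that it vanishes.\<close>

lemma (in sigma_finite_measure) sets_Collect_AE:
  assumes "{z \<in> space (N \<Otimes>\<^sub>M M). Q (fst z) (snd z)} \<in> sets (N \<Otimes>\<^sub>M M)"
  shows "{x \<in> space N. AE y in M. Q x y} \<in> sets N"
proof -
  let ?A = "{z \<in> space (N \<Otimes>\<^sub>M M). \<not> Q (fst z) (snd z)}"
  have A: "?A \<in> sets (N \<Otimes>\<^sub>M M)"
    using assms by (rule sets.sets_Collect_neg)
  have "(AE y in M. Q x y) \<longleftrightarrow> emeasure M (Pair x -` ?A) = 0" if "x \<in> space N" for x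
    using that by (intro AE_iff_measurable sets_Pair1[OF A]) (auto simp: space_pair_measure)
  then have "{x \<in> space N. AE y in M. Q x y} = {x \<in> space N. emeasure M (Pair x -` ?A) = 0}"
    by blast
  also have "\<dots> \<in> sets N"
    using measurable_emeasure_Pair[OF A] by measurable
  finally show ?thesis .
qed

lemma AE_lborel_translate:
  fixes c :: real
  shows "(AE x in lborel. Q (c + x)) \<longleftrightarrow> (AE x in lborel. Q x)"
proof -
  have *: "AE x in lborel. Q (c + x)" if "AE x in lborel. Q x" for Q :: "real \<Rightarrow> bool" and c
  proof -
    have eq: "distr lborel borel ((+) c) = lborel"
      by (rule lborel_distr_plus)
    have "AE x in distr lborel borel ((+) c). Q x"
      unfolding eq by (rule that)
    then show ?thesis
      by (rule AE_distrD[rotated]) simp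
  qed
  from *[of Q c] *[of "\<lambda>x. Q (c + x)" "- c"] show ?thesis
    by (simp only: add.assoc[symmetric] right_minus add_0_left) blast
qed

text \<open>Lebesgue measure is not zero. This serves to pick a typical observation time, and to
  drop an almost-everywhere quantifier from a statement that does not depend on its
  variable.\<close>

lemma AE_lborel_ex:
  assumes "AE x in lborel :: real measure. Q x"
  shows "\<exists>x. Q x"
proof (rule ccontr)
  assume "\<not> (\<exists>x. Q x)"
  with assms have "AE x in lborel :: real measure. False"
    by simp
  then have "ae_filter (lborel :: real measure) = bot"
    by (simp add: trivial_limit_def)
  then show False
    by (simp add: ae_filter_eq_bot_iff)
qed

text \<open>The set where \<open>M\<close> and \<open>M'\<close> differ is only known to lie inside
  a null set of \<open>P\<close>; completeness makes it measurable and null.\<close>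

lemma version_ofI:
  assumes P: "prob_space P" "space P = Omega0" and eq: "AE \<omega> in P. M \<omega> = M' \<omega>"
  shows "version_of (completion P) M' M"
proof -
  interpret W: prob_space "completion P"
    by (rule prob_space.prob_space_completion) fact
  obtain N where N: "N \<in> null_sets P" "{\<omega>\<in>space P. M \<omega> \<noteq> M' \<omega>} \<subseteq> N"
    using eq by (auto simp: eventually_ae_filter)
  then have null: "{\<omega>\<in>space P. M \<omega> \<noteq> M' \<omega>} \<in> null_sets (completion P)"
    by (intro null_sets_completion_subset[OF N(2)] null_sets_completionI)
  have "space (completion P) - {\<omega>\<in>space P. M \<omega> \<noteq> M' \<omega>} = {\<omega>\<in>Omega0. M \<omega> = M' \<omega>}"
    by (auto simp: P)
  moreover have "emeasure (completion P) (space (completion P) - {\<omega>\<in>space P. M \<omega> \<noteq> M' \<omega>}) = 1"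
    using W.emeasure_space_1 by (subst emeasure_Diff_null_set) (use null in auto)
  moreover have "space (completion P) - {\<omega>\<in>space P. M \<omega> \<noteq> M' \<omega>} \<in> sets (completion P)"
    using null by blast
  ultimately show ?thesis
    by (simp add: version_of_def)
qed

lemma levy_shift_levy_shift: "levy_shift u (levy_shift w \<omega>) = levy_shift (w + u) \<omega>"
  by (simp add: levy_shift_def fun_eq_iff add.assoc)

lemma levy_shift_0: "\<omega> \<in> Omega0 \<Longrightarrow> levy_shift 0 \<omega> = \<omega>"
  by (simp add: levy_shift_def Omega0_def)

section \<open>The set agreed on by almost all observation times\<close>

text \<open>The pair encodes a random countable set without the coffin state: \<open>v i\<close> is
  a candidate point and counts as present when \<open>d i\<close> is nonzero.\<close>

locale shifted_enumeration =
  fixes v d :: "nat \<Rightarrow> (real \<Rightarrow> real) \<Rightarrow> real"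
  assumes v: "v i \<in> borel_measurable borel_Omega0"
    and d: "d i \<in> borel_measurable borel_Omega0"
begin

text \<open>With \<open>N\<close> the enumerated set, this is
  \<open>u + N (levy_shift u \<omega>)\<close>: the points recorded by an observer at time
  \<open>u\<close>, written back on the original time axis.\<close>

definition seen_from :: "(real \<Rightarrow> real) \<Rightarrow> real \<Rightarrow> real set" where
  "seen_from \<omega> u = {u + v i (levy_shift u \<omega>) | i. d i (levy_shift u \<omega>) \<noteq> 0}"

text \<open>Coherence is what allows countability without a perfect set theorem for Borel sets.\<close>

definition coherent :: "(real \<Rightarrow> real) \<Rightarrow> bool" where
  "coherent \<omega> \<longleftrightarrow> (AE a in lborel. AE b in lborel. seen_from \<omega> a = seen_from \<omega> b)"

definition perfection :: "(real \<Rightarrow> real) \<Rightarrow> real set" where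
  "perfection \<omega> = {t. coherent \<omega> \<and> (AE u in lborel. t \<in> seen_from \<omega> u)}"

lemma seen_from_levy_shift: "seen_from (levy_shift w \<omega>) u = {t. w + t \<in> seen_from \<omega> (w + u)}"
  by (auto simp: seen_from_def levy_shift_levy_shift add.assoc)

lemma countable_seen_from: "countable (seen_from \<omega> u)"
proof -
  have "seen_from \<omega> u \<subseteq> range (\<lambda>i. u + v i (levy_shift u \<omega>))"
    by (auto simp: seen_from_def)
  then show ?thesis
    by (rule countable_subset) simp
qed

text \<open>Shifting the path translates every observed set by the same amount, which preserves
  equality between them, and replaces the observation time \<open>u\<close> by \<open>w + u\<close>,
  which Lebesgue-almost-everywhere statements do not notice.\<close>

lemma coherent_levy_shift: "coherent (levy_shift w \<omega>) \<longleftrightarrow> coherent \<omega>"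
proof -
  have inj: "{t. w + t \<in> A} = {t. w + t \<in> B} \<longleftrightarrow> A = B" for A B :: "real set"
    by (auto simp: set_eq_iff) (metis add.commute diff_add_cancel)+
  have "coherent (levy_shift w \<omega>) \<longleftrightarrow> (AE a in lborel. AE b in lborel. seen_from \<omega> (w + a) = seen_from \<omega> (w + b))"
    unfolding coherent_def seen_from_levy_shift inj ..
  also have "\<dots> \<longleftrightarrow> (AE a in lborel. AE b in lborel. seen_from \<omega> (w + a) = seen_from \<omega> b)"
    by (simp only: AE_lborel_translate[of "\<lambda>b. seen_from \<omega> x = seen_from \<omega> b" w for x])
  also have "\<dots> \<longleftrightarrow> coherent \<omega>"
    unfolding coherent_def by (rule AE_lborel_translate)
  finally show ?thesis .
qed

text \<open>The same change of observation time works path by path, so no exceptional set of paths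
  arises.\<close>

lemma perfectly_stationary_perfection: "perfectly_stationary perfection"
  unfolding perfectly_stationary_def
proof (intro allI ballI)
  fix w \<omega>
  have shift: "t \<in> perfection (levy_shift w \<omega>) \<longleftrightarrow> w + t \<in> perfection \<omega>" for t
    unfolding perfection_def coherent_levy_shift seen_from_levy_shift
    using AE_lborel_translate[of "\<lambda>u. w + t \<in> seen_from \<omega> u" w] by simp
  show "perfection \<omega> = (\<lambda>t. w + t) ` perfection (levy_shift w \<omega>)"
  proof (intro equalityI subsetI)
    fix t assume "t \<in> perfection \<omega>"
    then have "t - w \<in> perfection (levy_shift w \<omega>)"
      by (simp add: shift)
    then show "t \<in> (\<lambda>t. w + t) ` perfection (levy_shift w \<omega>)"
      by (rule rev_image_eqI) simp
  qed (auto simp: shift)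
qed

text \<open>On a coherent path some observed set, at time \<open>a\<close>, agrees with almost all
  others. A point lying in almost all of them therefore lies in this one countable set.\<close>

lemma countable_perfection: "countable (perfection \<omega>)"
proof (cases "coherent \<omega>")
  case True
  then obtain a where a: "AE b in lborel. seen_from \<omega> a = seen_from \<omega> b"
    unfolding coherent_def by (blast dest: AE_lborel_ex)
  have "perfection \<omega> \<subseteq> seen_from \<omega> a"
  proof
    fix t assume "t \<in> perfection \<omega>"
    then have "AE u in lborel. t \<in> seen_from \<omega> u"
      by (simp add: perfection_def)
    with a have "AE u in lborel :: real measure. t \<in> seen_from \<omega> a"
      by eventually_elim simp
    then show "t \<in> seen_from \<omega> a"
      by (blast dest: AE_lborel_ex)
  qed
  then show ?thesis
    using countable_seen_from by (rule countable_subset)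
qed (simp add: perfection_def)

section \<open>Measurability of the observed sets and of the perfection\<close>

text \<open>Membership is a countable disjunction over \<open>i\<close> of conditions on Borel
  functions. Path, observation time and point are arbitrary measurable functions on
  \<open>L\<close>, so that the lemma serves on all the products that occur below.\<close>

lemma seen_from_measurable:
  assumes f: "f \<in> measurable L borel_Omega0" "g \<in> borel_measurable L" "s \<in> borel_measurable L"
  shows "{z\<in>space L. s z \<in> seen_from (f z) (g z)} \<in> sets L"
proof -
  have "(\<lambda>z. levy_shift (g z) (f z)) \<in> measurable L borel_Omega0"
    using measurable_compose[OF measurable_Pair[OF f(1,2)] levy_shift_pair_measurable] by simp
  then have [measurable]: "(\<lambda>z. v i (levy_shift (g z) (f z))) \<in> borel_measurable L"
    "(\<lambda>z. d i (levy_shift (g z) (f z))) \<in> borel_measurable L" for i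
    using measurable_compose[OF _ v] measurable_compose[OF _ d] by auto
  note f(2,3)[measurable]
  have "{z\<in>space L. \<exists>i. s z = g z + v i (levy_shift (g z) (f z)) \<and> d i (levy_shift (g z) (f z)) \<noteq> 0} \<in> sets L"
    by measurable
  then show ?thesis
    by (simp add: seen_from_def)
qed

text \<open>Inclusion of enumerated sets is a countable conjunction: each point present in the first
  must belong to the second, which is the membership condition for the moving point
  \<open>g z + v i (levy_shift (g z) (f z))\<close>.\<close>

lemma seen_from_subset_measurable:
  assumes f: "f \<in> measurable L borel_Omega0" and g: "g \<in> borel_measurable L" "h \<in> borel_measurable L"
  shows "{z\<in>space L. seen_from (f z) (g z) \<subseteq> seen_from (f z) (h z)} \<in> sets L"
proof -
  have "(\<lambda>z. levy_shift (g z) (f z)) \<in> measurable L borel_Omega0"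
    using measurable_compose[OF measurable_Pair[OF f g(1)] levy_shift_pair_measurable] by simp
  then have m: "(\<lambda>z. v i (levy_shift (g z) (f z))) \<in> borel_measurable L"
    "(\<lambda>z. d i (levy_shift (g z) (f z))) \<in> borel_measurable L" for i
    using measurable_compose[OF _ v] measurable_compose[OF _ d] by auto
  have "{z\<in>space L. g z + v i (levy_shift (g z) (f z)) \<in> seen_from (f z) (h z)} \<in> sets L" for i
    by (intro seen_from_measurable f g borel_measurable_add m)
  moreover have "{z\<in>space L. d i (levy_shift (g z) (f z)) \<noteq> 0} \<in> sets L" for i
    using m(2) by measurable
  ultimately have "{z\<in>space L. \<forall>i. d i (levy_shift (g z) (f z)) \<noteq> 0 \<longrightarrow>
      g z + v i (levy_shift (g z) (f z)) \<in> seen_from (f z) (h z)} \<in> sets L"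
    by (intro sets.sets_Collect_countable_All sets.sets_Collect_imp)
  moreover have "seen_from \<omega> a \<subseteq> seen_from \<omega> b \<longleftrightarrow>
     (\<forall>i. d i (levy_shift a \<omega>) \<noteq> 0 \<longrightarrow> a + v i (levy_shift a \<omega>) \<in> seen_from \<omega> b)" for \<omega> a b
    unfolding seen_from_def[of \<omega> a] by blast
  ultimately show ?thesis
    by simp
qed

lemma seen_from_eq_measurable:
  assumes "f \<in> measurable L borel_Omega0" "g \<in> borel_measurable L" "h \<in> borel_measurable L"
  shows "{z\<in>space L. seen_from (f z) (g z) = seen_from (f z) (h z)} \<in> sets L"
  unfolding set_eq_subset by (intro sets.sets_Collect_conj seen_from_subset_measurable assms)

text \<open>Each almost-everywhere quantifier is removed by \<open>sets_Collect_AE\<close>, which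
  leaves an equality of observed sets on the product of path space with two copies of the
  line.\<close>

lemma coherent_measurable: "{\<omega>\<in>space borel_Omega0. coherent \<omega>} \<in> sets borel_Omega0"
  unfolding coherent_def
  by (intro lborel.sets_Collect_AE seen_from_eq_measurable) auto

lemma graph_of_perfection: "graph_of perfection \<in> sets (borel_Omega0 \<Otimes>\<^sub>M borel)"
proof -
  let ?L = "borel_Omega0 \<Otimes>\<^sub>M (borel :: real measure)"
  have "{z\<in>space ?L. AE u in lborel. snd z \<in> seen_from (fst z) u} \<in> sets ?L"
    by (intro lborel.sets_Collect_AE seen_from_measurable) auto
  moreover have "{z\<in>space ?L. coherent (fst z)} \<in> sets ?L"
    using measurable_sets_Collect[OF measurable_fst[of _ "borel :: real measure"] coherent_measurable] by simp
  ultimately have "{z\<in>space ?L. coherent (fst z) \<and> (AE u in lborel. snd z \<in> seen_from (fst z) u)} \<in> sets ?L"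
    by (intro sets.sets_Collect_conj)
  also have "{z\<in>space ?L. coherent (fst z) \<and> (AE u in lborel. snd z \<in> seen_from (fst z) u)} = graph_of perfection"
    by (auto simp: graph_of_def perfection_def space_pair_measure space_borel_Omega0)
  finally show ?thesis .
qed

text \<open>Fubini turns stationarity at each fixed \<open>u\<close> into agreement, for almost
  every path, of almost all observers with the observer at time \<open>0\<close>.\<close>

lemma AE_perfection_eq:
  assumes P: "prob_space P" "sets P = sets borel_Omega0"
    and stat: "\<And>u. AE \<omega> in P. seen_from \<omega> 0 = seen_from \<omega> u"
  shows "AE \<omega> in P. perfection \<omega> = seen_from \<omega> 0"
proof -
  interpret P: prob_space P by fact
  interpret pair_sigma_finite P lborel ..
  have m: "f \<in> measurable L borel_Omega0 \<longleftrightarrow> f \<in> measurable L P" for f and L :: "'c measure"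
    using measurable_cong_sets[OF refl P(2)] by blast
  have "{z \<in> space (P \<Otimes>\<^sub>M lborel). seen_from (fst z) 0 = seen_from (fst z) (snd z)} \<in> sets (P \<Otimes>\<^sub>M lborel)"
    by (intro seen_from_eq_measurable) (auto simp: m)
  \<comment> \<open>The null set in \<open>stat\<close> depends on \<open>u\<close>; after
    exchanging the quantifiers a single null set of paths remains.\<close>
  then have "AE \<omega> in P. AE u in lborel. seen_from \<omega> 0 = seen_from \<omega> u"
    by (subst AE_commute) (auto simp: stat)
  then show ?thesis
  proof eventually_elim
    case (elim \<omega>)
    \<comment> \<open>Both sets are compared with \<open>seen_from \<omega> 0\<close>.\<close>
    have "AE a in lborel. AE b in lborel. seen_from \<omega> a = seen_from \<omega> b"
      using elim
    proof eventually_elim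
      case *: (elim a)
      from elim show ?case
        by eventually_elim (simp flip: *)
    qed
    then have "coherent \<omega>"
      by (simp add: coherent_def)
    have "(AE u in lborel. t \<in> seen_from \<omega> u) \<longleftrightarrow> t \<in> seen_from \<omega> 0" for t
    proof
      assume "AE u in lborel. t \<in> seen_from \<omega> u"
      with elim have "AE u in lborel :: real measure. t \<in> seen_from \<omega> 0"
        by eventually_elim simp
      then show "t \<in> seen_from \<omega> 0"
        by (blast dest: AE_lborel_ex)
    next
      assume "t \<in> seen_from \<omega> 0"
      with elim show "AE u in lborel. t \<in> seen_from \<omega> u"
        by (auto elim: eventually_mono)
    qed
    with \<open>coherent \<omega>\<close> show ?case
      by (auto simp: perfection_def)
  qed
qed

end

theorem proposition3p17:
  fixes W :: "(real \<Rightarrow> real) measure" and M :: "(real \<Rightarrow> real) \<Rightarrow> real set"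
  assumes "completed_wiener_measure W"
    and "random_countable_set W M"
    and "stationary W M"
  shows "\<exists>M'. version_of W M' M \<and> perfectly_stationary M' \<and>
    (\<forall>\<omega>\<in>Omega0. countable (M' \<omega>)) \<and>
    graph_of M' \<in> sets (borel_Omega0 \<Otimes>\<^sub>M borel)"
proof -
  obtain P where P: "two_sided_wiener_measure P" and W: "W = completion P"
    using assms(1) by (auto simp: completed_wiener_measure_def)
  have prob: "prob_space P"
    using P by (simp add: two_sided_wiener_measure_def)
  note sets = sets_wiener[OF P]
  have sp: "space P = Omega0"
    using sets_eq_imp_space_eq[OF sets] by (simp add: space_borel_Omega0)
  from random_countable_set_borel_version[OF assms(2)[unfolded W]]
  obtain v d :: "nat \<Rightarrow> (real \<Rightarrow> real) \<Rightarrow> real" where v: "\<And>i. v i \<in> borel_measurable P" and d: "\<And>i. d i \<in> borel_measurable P"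
    and M: "AE \<omega> in P. M \<omega> = {v i \<omega> | i. d i \<omega> \<noteq> 0}"
    by blast
  interpret shifted_enumeration v d
    using v d measurable_cong_sets[OF sets refl] by unfold_locales blast+
  have shift: "levy_shift u \<in> measurable P borel_Omega0" for u
    using levy_shift_measurable measurable_cong_sets[OF sets refl] by blast
  \<comment> \<open>Observation at time \<open>0\<close> gives the enumerated set itself, since
    \<open>levy_shift 0\<close> is the identity on \<open>Omega0\<close>.\<close>
  have M_eq: "AE \<omega> in P. M \<omega> = seen_from \<omega> 0"
    using M AE_space by eventually_elim (simp add: seen_from_def levy_shift_0 sp)
  have "AE \<omega> in P. seen_from \<omega> 0 = seen_from \<omega> u" for u
  proof -
    have "AE \<omega> in P. M \<omega> = (\<lambda>t. u + t) ` M (levy_shift u \<omega>)"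
      using assms(3) unfolding W stationary_def AE_completion_iff by blast
    \<comment> \<open>The null set where \<open>M\<close> differs from its Borel enumeration is
      pulled back along the shift; it stays null because the shift preserves
      \<open>P\<close>.\<close>
    moreover have "AE \<omega> in P. M (levy_shift u \<omega>) = {v i (levy_shift u \<omega>) | i. d i (levy_shift u \<omega>) \<noteq> 0}"
      by (rule AE_distrD[OF shift[of u], of "\<lambda>\<omega>. M \<omega> = {v i \<omega> | i. d i \<omega> \<noteq> 0}"])
        (unfold distr_wiener_levy_shift[OF P], rule M)
    ultimately show ?thesis
      using M_eq by eventually_elim (auto simp: seen_from_def)
  qed
  then have "AE \<omega> in P. perfection \<omega> = seen_from \<omega> 0"
    by (rule AE_perfection_eq[OF prob sets])
  with M_eq have "AE \<omega> in P. M \<omega> = perfection \<omega>"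
    by eventually_elim simp
  then have "version_of W perfection M"
    unfolding W by (rule version_ofI[OF prob sp])
  with perfectly_stationary_perfection countable_perfection graph_of_perfection show ?thesis
    by blast
qed

end
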